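(* Let $\Sigma$ be a (non-random) positive semidefinite $d\times d$ matrix, let $(X_t)_{t\ge 1}$ be random vectors in $\mathbb{R}^d$ with constant conditional mean $\mathbb{E}[X_t\mid\mathcal{F}_{t-1}]=\mu$ for all $t\ge 1$, and suppose $(X_t)$ is conditionally $\Sigma$-sub-Gaussian. Fix some $n\in\mathbb{N}$, $n\ge 1$, and $\alpha\in(0,1)$. Then, with probability at least $1-\alpha$, simultaneously for all $t\geq 1$, $$\left\|\frac{1}{t}\sum_{i=1}^t X_i - \mu\right\| \leq \left(\frac{1}{2\sqrt{n}} + \frac{\sqrt{n}}{2t}\right)\left(\sqrt{\mathrm{Tr}(\Sigma)} + \sqrt{2\|\Sigma\|\log(1/\alpha)} \right).$$
   Context: $\mathcal{F}_t=\sigma(X_1,\dots,X_t)$ ($\mathcal{F}_0$ trivial). $\|\cdot\|$ is the Euclidean norm for vectors and the operator norm for matrices. $(X_t)$ is conditionally $\Sigma$-sub-Gaussian if for every $t\ge1$, $\mathbb{E}[\exp\{\lambda\langle\theta,X_t-\mu\rangle-\tfrac{\lambda^2}{2}\langle\theta,\Sigma\theta\rangle\}\mid\mathcal{F}_{t-1}]\le 1$ for all $\theta\in\mathbb{R}^d$ and $\lambda\in\mathbb{R}$. *)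

theory Defs
  imports "HOL-Probability.Probability"
begin

definition pos_semidef :: "real ^ 'n ^ 'n \<Rightarrow> bool" where
  "pos_semidef S \<longleftrightarrow> transpose S = S \<and> (\<forall>\<theta>. 0 \<le> \<theta> \<bullet> (S *v \<theta>))"

definition op_norm :: "real ^ 'n ^ 'm \<Rightarrow> real" where
  "op_norm S = onorm (\<lambda>v. S *v v)"

text \<open>The process starts at time 1: the value of \<open>X 0\<close> is never used, and
  \<open>history M X 0\<close> is the trivial sigma-algebra.\<close>

definition history :: "'a measure \<Rightarrow> (nat \<Rightarrow> 'a \<Rightarrow> 'b::topological_space) \<Rightarrow> nat \<Rightarrow> 'a measure" where
  "history M X t = sigma (space M) {X i -` B \<inter> space M | i B. i \<in> {1..t} \<and> B \<in> sets borel}"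

text \<open>The library conditional expectation \<^const>\<open>nn_cond_exp\<close> and \<^const>\<open>real_cond_exp\<close>
  are meaningful only for a sub-sigma-algebra that is sigma-finite for the measure.\<close>

lemma subalgebra_history:
  assumes "\<And>i. i \<ge> 1 \<Longrightarrow> X i \<in> borel_measurable M"
  shows "subalgebra M (history M X t)"
proof -
  let ?G = "{X i -` B \<inter> space M | i B. i \<in> {1..t} \<and> B \<in> sets borel}"
  have "?G \<subseteq> sets M"
    using assms by (auto intro!: measurable_sets)
  then have "sigma_sets (space M) ?G \<subseteq> sets M"
    by (rule sets.sigma_sets_subset)
  moreover have "?G \<subseteq> Pow (space M)" by auto
  ultimately show ?thesis
    unfolding subalgebra_def history_def by (simp add: sets_measure_of space_measure_of)
qed

lemma sigma_finite_history:
  assumes "prob_space M" and "\<And>i. i \<ge> 1 \<Longrightarrow> X i \<in> borel_measurable M"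
  shows "sigma_finite_subalgebra M (history M X t)"
  using assms prob_space.finite_measure subalgebra_history
  by (metis finite_measure_subalgebra.intro finite_measure_subalgebra_axioms.intro
      finite_measure_subalgebra.axioms(1) finite_measure_subalgebra_is_sigma_finite)

lemma sets_history_0: "sets (history M X 0) = {{}, space M}"
  unfolding history_def by (simp add: sigma_sets_empty_eq)

text \<open>The conditional expectation of a random vector is taken coordinatewise.
  Integrability is required explicitly, since \<^const>\<open>real_cond_exp\<close> is total.\<close>

definition has_cond_mean :: "'a measure \<Rightarrow> 'a measure \<Rightarrow> ('a \<Rightarrow> real ^ 'n) \<Rightarrow> real ^ 'n \<Rightarrow> bool" where
  "has_cond_mean M F Y \<mu> \<longleftrightarrow>
     integrable M Y \<and> (\<forall>i. AE \<omega> in M. real_cond_exp M F (\<lambda>\<omega>'. Y \<omega>' $ i) \<omega> = \<mu> $ i)"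

text \<open>The exponential is positive but not assumed integrable, so its conditional expectation
  is the extended nonnegative one. Conditional expectations are versions, so the inequality
  holds almost surely for each \<open>\<theta>\<close> and \<open>\<lambda>\<close>.\<close>

definition cond_sub_gaussian ::
    "'a measure \<Rightarrow> (nat \<Rightarrow> 'a \<Rightarrow> real ^ 'n) \<Rightarrow> real ^ 'n \<Rightarrow> real ^ 'n ^ 'n \<Rightarrow> bool" where
  "cond_sub_gaussian M X \<mu> S \<longleftrightarrow>
     (\<forall>t\<ge>1. \<forall>\<theta> (l::real). AE \<omega> in M.
        nn_cond_exp M (history M X (t - 1))
          (\<lambda>\<omega>'. ennreal (exp (l * (\<theta> \<bullet> (X t \<omega>' - \<mu>)) - l\<^sup>2 / 2 * (\<theta> \<bullet> (S *v \<theta>))))) \<omega> \<le> 1)"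

end

theory Submission
  imports Defs
begin

text \<open>Method of mixtures with a PAC-Bayes lower bound. For \<open>Z t = (\<Sum>i=1..t. X i - \<mu>)\<close> and every fixed
  \<open>\<theta>\<close>, the process \<open>exp (l * (\<theta> \<bullet> Z t) - l\<^sup>2 / 2 * t * (\<theta> \<bullet> (\<Sigma> *v \<theta>)))\<close> is a nonnegative supermartingale,
  hence so is its average over an isotropic centred Gaussian \<open>\<theta>\<close> of variance \<open>\<sigma>\<^sup>2\<close>, and Ville's
  inequality keeps the average below \<open>1 / \<alpha>\<close> for all times at once. Recentring the Gaussian at the
  unit vector \<open>u\<close> in direction \<open>Z t\<close> costs a density factor, and Jensen's inequality then bounds the
  average from below by
  \<open>exp (l * norm (Z t) - l\<^sup>2 / 2 * t * (u \<bullet> (\<Sigma> *v u) + \<sigma>\<^sup>2 * trace \<Sigma>) - 1 / (2 * \<sigma>\<^sup>2))\<close>.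
  The claim follows by optimising \<open>l\<close> and \<open>\<sigma>\<close> for time \<open>n\<close>.\<close>

section \<open>Gaussian integrals over a Euclidean space\<close>

text \<open>Fubini: \<open>lborel\<close> is the image of a product of real Lebesgue measures under
  the map that assembles a vector from its coordinates. This reduces Gaussian moments to dimension
  one.\<close>

lemma has_bochner_integral_lborel_prod:
  fixes f :: "'a::euclidean_space \<Rightarrow> real \<Rightarrow> real"
  assumes "\<And>b. b \<in> Basis \<Longrightarrow> has_bochner_integral lborel (f b) (c b)"
  shows "has_bochner_integral lborel (\<lambda>x. \<Prod>b\<in>Basis. f b (x \<bullet> b)) (\<Prod>b\<in>Basis. c b)"
proof -
  interpret product_sigma_finite "\<lambda>_::'a. lborel :: real measure" ..
  have f: "integrable lborel (f b)" "integral\<^sup>L lborel (f b) = c b" if "b \<in> Basis" for b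
    using assms[OF that] by (auto simp: has_bochner_integral_iff)
  have fm [measurable]: "f b \<in> borel_measurable borel" if "b \<in> Basis" for b
    using borel_measurable_integrable[OF f(1)[OF that]] by simp
  have coord: "(\<Sum>b\<in>Basis. y b *\<^sub>R b) \<bullet> b' = y b'" if "b' \<in> Basis" for y and b' :: 'a
    using that by simp
  have "has_bochner_integral (\<Pi>\<^sub>M b\<in>Basis. lborel) (\<lambda>y. \<Prod>b\<in>Basis. f b (y b)) (\<Prod>b\<in>Basis. c b)"
    using f by (simp add: has_bochner_integral_iff product_integrable_prod product_integral_prod)
  then have "has_bochner_integral (\<Pi>\<^sub>M b\<in>Basis. lborel)
      (\<lambda>y. \<Prod>b\<in>Basis. f b ((\<Sum>b\<in>Basis. y b *\<^sub>R b) \<bullet> b)) (\<Prod>b\<in>Basis. c b)"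
    by (simp add: coord cong: prod.cong)
  then show ?thesis
    by (subst lborel_eq) (intro has_bochner_integral_distr, measurable)
qed

text \<open>The Gaussian density with mean zero and covariance \<open>\<sigma>\<^sup>2\<close> times
  the identity. The product form, rather than the closed form in \<open>norm x\<close>, fits the
  factorisation of integrals over coordinates.\<close>

definition iso_normal_density :: "real \<Rightarrow> 'a::euclidean_space \<Rightarrow> real" where
  "iso_normal_density \<sigma> x = (\<Prod>b\<in>Basis. normal_density 0 \<sigma> (x \<bullet> b))"

lemma iso_normal_density_nonneg [simp]: "0 \<le> iso_normal_density \<sigma> x"
  by (simp add: iso_normal_density_def prod_nonneg)

lemma borel_measurable_iso_normal_density [measurable]:
  "iso_normal_density \<sigma> \<in> borel_measurable borel"
  unfolding iso_normal_density_def[abs_def] by measurable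

text \<open>Completing the square in each coordinate produces the Cameron-Martin factor, which is
  the price of recentring the mixture at \<open>u\<close>.\<close>

lemma iso_normal_density_add:
  fixes u x :: "'a::euclidean_space"
  shows "iso_normal_density \<sigma> (u + x)
    = exp (- (u \<bullet> x) / \<sigma>\<^sup>2 - (norm u)\<^sup>2 / (2 * \<sigma>\<^sup>2)) * iso_normal_density \<sigma> x"
proof -
  have "normal_density 0 \<sigma> (a + y) = exp (- (a * y) / \<sigma>\<^sup>2 - a\<^sup>2 / (2 * \<sigma>\<^sup>2)) * normal_density 0 \<sigma> y"
    for a y :: real
  proof -
    \<comment> \<open>For \<open>\<sigma> = 0\<close> both sides are 0, since division by zero
      yields 0.\<close>
    have "- (a + y)\<^sup>2 / (2 * \<sigma>\<^sup>2) = (- (a * y) / \<sigma>\<^sup>2 - a\<^sup>2 / (2 * \<sigma>\<^sup>2)) + - y\<^sup>2 / (2 * \<sigma>\<^sup>2)"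
      by (cases "\<sigma> = 0") (auto simp: field_simps power2_eq_square)
    then show ?thesis
      by (simp add: normal_density_def mult_exp_exp)
  qed
  then have "iso_normal_density \<sigma> (u + x)
      = (\<Prod>b\<in>Basis. exp (- ((u \<bullet> b) * (x \<bullet> b)) / \<sigma>\<^sup>2 - (u \<bullet> b)\<^sup>2 / (2 * \<sigma>\<^sup>2)))
        * iso_normal_density \<sigma> x"
    by (simp add: iso_normal_density_def inner_add_left prod.distrib)
  also have "(\<Prod>b\<in>Basis. exp (- ((u \<bullet> b) * (x \<bullet> b)) / \<sigma>\<^sup>2 - (u \<bullet> b)\<^sup>2 / (2 * \<sigma>\<^sup>2)))
      = exp (- (u \<bullet> x) / \<sigma>\<^sup>2 - (norm u)\<^sup>2 / (2 * \<sigma>\<^sup>2))"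
    by (simp add: exp_sum[symmetric] sum_subtractf sum_negf sum_divide_distrib[symmetric]
        euclidean_inner[of u x] euclidean_inner[of u u] power2_norm_eq_inner)
      (simp add: power2_eq_square)
  finally show ?thesis .
qed

text \<open>Each monomial is a product of one-dimensional factors, so everything follows from the
  mass, mean and second moment of \<open>normal_density 0 \<sigma>\<close>.\<close>

lemma has_bochner_integral_iso_normal:
  assumes "0 < \<sigma>"
  shows has_bochner_integral_iso_normal_density:
      "has_bochner_integral lborel (iso_normal_density \<sigma> :: 'a::euclidean_space \<Rightarrow> real) 1"
    and has_bochner_integral_iso_normal_first_moment:
      "\<And>b::'a. b \<in> Basis \<Longrightarrow>
        has_bochner_integral lborel (\<lambda>x. (x \<bullet> b) * iso_normal_density \<sigma> x) 0"
    and has_bochner_integral_iso_normal_second_moment: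
      "\<And>b b'::'a. b \<in> Basis \<Longrightarrow> b' \<in> Basis \<Longrightarrow>
        has_bochner_integral lborel (\<lambda>x. (x \<bullet> b) * (x \<bullet> b') * iso_normal_density \<sigma> x)
          (if b = b' then \<sigma>\<^sup>2 else 0)"
proof -
  have m0: "has_bochner_integral lborel (normal_density 0 \<sigma>) 1"
    using normal_moment_even[OF assms, of 0 0] by simp
  have m1: "has_bochner_integral lborel (\<lambda>y. y * normal_density 0 \<sigma> y) 0"
    using normal_moment_odd[OF assms, of 0 0] by (simp add: mult.commute)
  have m2: "has_bochner_integral lborel (\<lambda>y. y\<^sup>2 * normal_density 0 \<sigma> y) (\<sigma>\<^sup>2)"
    using normal_moment_even[OF assms, of 0 1] by (simp add: mult.commute)
  show "has_bochner_integral lborel (iso_normal_density \<sigma> :: 'a \<Rightarrow> real) 1"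
    using has_bochner_integral_lborel_prod[of "\<lambda>_. normal_density 0 \<sigma>" "\<lambda>_. 1"] m0
    by (simp add: iso_normal_density_def[abs_def])
  show "has_bochner_integral lborel (\<lambda>x. (x \<bullet> b) * iso_normal_density \<sigma> x) 0"
    if b: "b \<in> Basis" for b :: 'a
  proof -
    \<comment> \<open>The factor 1 in the remaining coordinates turns the monomial into a product
      over all of \<open>Basis\<close>.\<close>
    have "has_bochner_integral lborel
        (\<lambda>x. \<Prod>c\<in>Basis. (if c = b then x \<bullet> c else 1) * normal_density 0 \<sigma> (x \<bullet> c))
        (\<Prod>c\<in>Basis. if c = b then 0 else 1)"
      using m0 m1 by (intro has_bochner_integral_lborel_prod
          [where f = "\<lambda>c y. (if c = b then y else 1) * normal_density 0 \<sigma> y"]) auto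
    then show ?thesis
      using b by (simp add: prod.distrib iso_normal_density_def)
  qed
  show "has_bochner_integral lborel (\<lambda>x. (x \<bullet> b) * (x \<bullet> b') * iso_normal_density \<sigma> x)
      (if b = b' then \<sigma>\<^sup>2 else 0)"
    if b: "b \<in> Basis" "b' \<in> Basis" for b b' :: 'a
  proof -
    \<comment> \<open>\<open>v c\<close> is the integral of the factor at coordinate
      \<open>c\<close>: a second moment if both indices hit \<open>c\<close>, a vanishing first
      moment if exactly one does, and total mass 1 otherwise.\<close>
    define v where "v c = (if c = b \<and> c = b' then \<sigma>\<^sup>2 else if c = b \<or> c = b' then 0 else 1)" for c
    have "has_bochner_integral lborel
        (\<lambda>x. \<Prod>c\<in>Basis. (if c = b then x \<bullet> c else 1) * (if c = b' then x \<bullet> c else 1)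
          * normal_density 0 \<sigma> (x \<bullet> c)) (\<Prod>c\<in>Basis. v c)"
      using m0 m1 m2 by (intro has_bochner_integral_lborel_prod
          [where f = "\<lambda>c y. (if c = b then y else 1) * (if c = b' then y else 1) * normal_density 0 \<sigma> y"])
        (auto simp: v_def power2_eq_square)
    moreover have "(\<Prod>c\<in>Basis. v c) = (if b = b' then \<sigma>\<^sup>2 else 0)"
    proof (cases "b = b'")
      case True
      then have "v c = (if c = b then \<sigma>\<^sup>2 else 1)" for c
        by (simp add: v_def)
      with True b show ?thesis by simp
    next
      case False
      with b show ?thesis by (auto simp: v_def intro!: bexI[of _ b])
    qed
    ultimately show ?thesis
      using b by (simp add: prod.distrib iso_normal_density_def)
  qed
qed

text \<open>In coordinates, the linear and mixed terms integrate to 0 and each square contributes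
  \<open>\<sigma>\<^sup>2\<close>, which leaves the trace of \<open>A\<close>. This is the mean of
  the exponent needed for Jensen's inequality.\<close>

lemma has_bochner_integral_iso_normal_quadratic:
  fixes w :: "'a::euclidean_space"
  assumes "0 < \<sigma>" and "linear A"
  shows "has_bochner_integral lborel (\<lambda>x. (a + w \<bullet> x - k * (x \<bullet> A x)) * iso_normal_density \<sigma> x)
    (a - k * \<sigma>\<^sup>2 * (\<Sum>b\<in>Basis. b \<bullet> A b))"
proof -
  interpret A: linear A by fact
  have quad: "x \<bullet> A x = (\<Sum>b\<in>Basis. \<Sum>b'\<in>Basis. (b \<bullet> A b') * ((x \<bullet> b) * (x \<bullet> b')))" for x
  proof -
    have "A x = (\<Sum>b'\<in>Basis. (x \<bullet> b') *\<^sub>R A b')"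
      by (subst euclidean_representation[of x, symmetric]) (simp only: A.sum A.scale)
    then have "x \<bullet> A x = (\<Sum>b\<in>Basis. (x \<bullet> b) * (\<Sum>b'\<in>Basis. (x \<bullet> b') * (A b' \<bullet> b)))"
      by (subst euclidean_inner) (simp add: inner_sum_left)
    then show ?thesis
      by (simp add: sum_distrib_left inner_commute mult_ac)
  qed
  have "has_bochner_integral lborel
      (\<lambda>x. a * iso_normal_density \<sigma> x
        + (\<Sum>b\<in>Basis. (w \<bullet> b) * ((x \<bullet> b) * iso_normal_density \<sigma> x))
        - k * (\<Sum>b\<in>Basis. \<Sum>b'\<in>Basis. (b \<bullet> A b') * ((x \<bullet> b) * (x \<bullet> b') * iso_normal_density \<sigma> x)))
      (a * 1 + (\<Sum>b\<in>Basis. (w \<bullet> b) * 0)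
        - k * (\<Sum>b\<in>Basis. \<Sum>b'\<in>Basis. (b \<bullet> A b') * (if b = b' then \<sigma>\<^sup>2 else 0)))"
    using assms(1)
    by (intro has_bochner_integral_add has_bochner_integral_diff has_bochner_integral_mult_right
        has_bochner_integral_sum has_bochner_integral_iso_normal) auto
  moreover have "a * 1 + (\<Sum>b\<in>Basis. (w \<bullet> b) * 0)
        - k * (\<Sum>b\<in>Basis. \<Sum>b'\<in>Basis. (b \<bullet> A b') * (if b = b' then \<sigma>\<^sup>2 else 0))
      = a - k * \<sigma>\<^sup>2 * (\<Sum>b\<in>Basis. b \<bullet> A b)"
    by (simp add: if_distrib[where f = "(*) _"] sum.delta sum_distrib_left mult_ac cong: if_cong)
  moreover have "a * iso_normal_density \<sigma> x
        + (\<Sum>b\<in>Basis. (w \<bullet> b) * ((x \<bullet> b) * iso_normal_density \<sigma> x))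
        - k * (\<Sum>b\<in>Basis. \<Sum>b'\<in>Basis. (b \<bullet> A b') * ((x \<bullet> b) * (x \<bullet> b') * iso_normal_density \<sigma> x))
      = (a + w \<bullet> x - k * (x \<bullet> A x)) * iso_normal_density \<sigma> x" for x
    by (simp add: quad euclidean_inner[of w x] algebra_simps sum_distrib_left sum_distrib_right)
  ultimately show ?thesis
    by (simp only:)
qed

section \<open>Lower bounds for Gaussian averages of exponentials of quadratics\<close>

lemma borel_measurable_linear:
  fixes A :: "'a::euclidean_space \<Rightarrow> 'b::real_normed_vector"
  shows "linear A \<Longrightarrow> A \<in> borel_measurable borel"
  by (intro borel_measurable_continuous_onI linear_continuous_on)
    (simp add: linear_conv_bounded_linear)

lemma exp_quadratic_iso_normal_ge:
  fixes w :: "'a::euclidean_space"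
  assumes "0 < \<sigma>" and "linear A"
  shows "ennreal (exp (a - k * \<sigma>\<^sup>2 * (\<Sum>b\<in>Basis. b \<bullet> A b)))
    \<le> (\<integral>\<^sup>+x. ennreal (exp (a + w \<bullet> x - k * (x \<bullet> A x)) * iso_normal_density \<sigma> x) \<partial>lborel)"
    (is "ennreal (exp ?m) \<le> (\<integral>\<^sup>+x. ennreal (exp (?h x) * _) \<partial>lborel)")
  \<comment> \<open>Jensen's inequality via the tangent line of \<open>exp\<close> at the mean \<open>?m\<close> of \<open>?h\<close>, so that
    integrability of \<open>exp \<circ> ?h\<close> is needed only when the integral is finite.\<close>
proof (cases "(\<integral>\<^sup>+x. ennreal (exp (?h x) * iso_normal_density \<sigma> x) \<partial>lborel) = \<infinity>")
  case False
  let ?\<phi> = "iso_normal_density \<sigma> :: 'a \<Rightarrow> real"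
  have [measurable]: "A \<in> borel_measurable borel"
    using assms(2) by (rule borel_measurable_linear)
  have int: "integrable lborel (\<lambda>x. exp (?h x) * ?\<phi> x)"
    using False by (intro integrableI_nonneg) (auto simp: top.not_eq_extremum)
  \<comment> \<open>The tangent line at the mean integrates to exactly \<open>exp ?m\<close>,
    because \<open>?h\<close> has mean \<open>?m\<close>.\<close>
  have "has_bochner_integral lborel (\<lambda>x. exp ?m * ((1 - ?m) * ?\<phi> x + ?h x * ?\<phi> x))
      (exp ?m * ((1 - ?m) * 1 + ?m))"
    using assms by (intro has_bochner_integral_mult_right has_bochner_integral_add
        has_bochner_integral_iso_normal_quadratic has_bochner_integral_iso_normal)
  then have "has_bochner_integral lborel (\<lambda>x. exp ?m * (1 + (?h x - ?m)) * ?\<phi> x) (exp ?m)"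
    by (simp add: algebra_simps)
  moreover have "exp ?m * (1 + (?h x - ?m)) * ?\<phi> x \<le> exp (?h x) * ?\<phi> x" for x
  proof (intro mult_right_mono)
    have "exp ?m * (1 + (?h x - ?m)) \<le> exp ?m * exp (?h x - ?m)"
      by (intro mult_left_mono exp_ge_add_one_self) auto
    also have "exp ?m * exp (?h x - ?m) = exp (?h x)"
      by (metis add.commute diff_add_cancel mult_exp_exp)
    finally show "exp ?m * (1 + (?h x - ?m)) \<le> exp (?h x)" .
  qed simp
  ultimately have "exp ?m \<le> (\<integral>x. exp (?h x) * ?\<phi> x \<partial>lborel)"
    using int by (metis (no_types, lifting) has_bochner_integral_iff integral_mono)
  then show ?thesis
    using int by (subst nn_integral_eq_integral) (auto intro!: ennreal_leI)
qed simp

text \<open>Translation invariance of \<open>lborel\<close> moves the Gaussian to centre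
  \<open>u\<close>; the density factor joins the exponent, which stays quadratic, so the previous
  bound applies. The loss \<open>(norm u)\<^sup>2 / (2 * \<sigma>\<^sup>2)\<close> is the relative
  entropy of the shifted Gaussian with respect to the centred one.\<close>

lemma exp_quadratic_iso_normal_ge_shift:
  fixes u :: "'a::euclidean_space"
  assumes "0 < \<sigma>" and "linear A"
  shows "ennreal (exp (u \<bullet> s - k * (u \<bullet> A u + \<sigma>\<^sup>2 * (\<Sum>b\<in>Basis. b \<bullet> A b)) - (norm u)\<^sup>2 / (2 * \<sigma>\<^sup>2)))
    \<le> (\<integral>\<^sup>+x. ennreal (exp (x \<bullet> s - k * (x \<bullet> A x)) * iso_normal_density \<sigma> x) \<partial>lborel)"
proof -
  interpret A: linear A by fact
  have [measurable]: "A \<in> borel_measurable borel"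
    using assms(2) by (rule borel_measurable_linear)
  \<comment> \<open>\<open>a\<close> and \<open>w\<close> are the constant and linear coefficients,
    in the deviation \<open>x\<close> from \<open>u\<close>, of the exponent with the density factor
    included. The adjoint turns \<open>u \<bullet> A x\<close> into an inner product with
    \<open>x\<close>.\<close>
  define a where "a = u \<bullet> s - k * (u \<bullet> A u) - (norm u)\<^sup>2 / (2 * \<sigma>\<^sup>2)"
  define w where "w = s - k *\<^sub>R (A u + adjoint A u) - (1 / \<sigma>\<^sup>2) *\<^sub>R u"
  have w: "w \<bullet> x = x \<bullet> s - k * (u \<bullet> A x + x \<bullet> A u) - (u \<bullet> x) / \<sigma>\<^sup>2" for x
    by (simp add: w_def inner_diff_left inner_add_left adjoint_works[OF assms(2)] inner_commute)
      (simp add: algebra_simps adjoint_works[OF assms(2)] inner_commute)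
  have "ennreal (exp (u \<bullet> s - k * (u \<bullet> A u + \<sigma>\<^sup>2 * (\<Sum>b\<in>Basis. b \<bullet> A b)) - (norm u)\<^sup>2 / (2 * \<sigma>\<^sup>2)))
      = ennreal (exp (a - k * \<sigma>\<^sup>2 * (\<Sum>b\<in>Basis. b \<bullet> A b)))"
    by (simp add: a_def algebra_simps)
  also have "\<dots> \<le> (\<integral>\<^sup>+x. ennreal (exp (a + w \<bullet> x - k * (x \<bullet> A x)) * iso_normal_density \<sigma> x) \<partial>lborel)"
    by (rule exp_quadratic_iso_normal_ge[OF assms])
  also have "\<dots> = (\<integral>\<^sup>+x. ennreal (exp ((u + x) \<bullet> s - k * ((u + x) \<bullet> A (u + x)))
      * iso_normal_density \<sigma> (u + x)) \<partial>lborel)"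
  proof (rule nn_integral_cong)
    fix x :: 'a
    have "a + w \<bullet> x - k * (x \<bullet> A x) = ((u + x) \<bullet> s - k * ((u + x) \<bullet> A (u + x)))
        + (- (u \<bullet> x) / \<sigma>\<^sup>2 - (norm u)\<^sup>2 / (2 * \<sigma>\<^sup>2))"
      by (simp add: w a_def A.add algebra_simps)
    then show "ennreal (exp (a + w \<bullet> x - k * (x \<bullet> A x)) * iso_normal_density \<sigma> x)
        = ennreal (exp ((u + x) \<bullet> s - k * ((u + x) \<bullet> A (u + x))) * iso_normal_density \<sigma> (u + x))"
      by (simp only: iso_normal_density_add exp_add mult.assoc)
  qed
  also have "\<dots> = (\<integral>\<^sup>+x. ennreal (exp (x \<bullet> s - k * (x \<bullet> A x)) * iso_normal_density \<sigma> x)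
      \<partial>distr lborel borel ((+) u))"
    by (subst nn_integral_distr) auto
  finally show ?thesis
    by (simp add: lborel_distr_plus)
qed

section \<open>Ville's maximal inequality\<close>

text \<open>Markov's inequality for the process stopped on reaching \<open>1 / \<alpha>\<close>
  bounds the probability of doing so by any finite time. The supermartingale property is phrased
  through integrals over events, a form that mixing over a parameter preserves by Tonelli.\<close>

lemma ville_inequality:
  fixes W :: "nat \<Rightarrow> 'a \<Rightarrow> ennreal"
  assumes "prob_space M"
    and sub: "\<And>t. subalgebra M (F t)"
    and mono: "\<And>s t. s \<le> t \<Longrightarrow> sets (F s) \<subseteq> sets (F t)"
    and adapted: "\<And>t. W t \<in> borel_measurable (F t)"
    and super: "\<And>t A. A \<in> sets (F t) \<Longrightarrow>
      (\<integral>\<^sup>+\<omega>. W (Suc t) \<omega> * indicator A \<omega> \<partial>M) \<le> (\<integral>\<^sup>+\<omega>. W t \<omega> * indicator A \<omega> \<partial>M)"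
    and init: "(\<integral>\<^sup>+\<omega>. W 0 \<omega> \<partial>M) \<le> 1"
    and "0 < \<alpha>"
  shows "measure M {\<omega> \<in> space M. \<forall>t. W t \<omega> < ennreal (1 / \<alpha>)} \<ge> 1 - \<alpha>"
proof -
  interpret prob_space M by fact
  let ?c = "ennreal (1 / \<alpha>)"
  define G where "G t = {\<omega> \<in> space M. \<forall>s\<le>t. W s \<omega> < ?c}" for t
  have spF: "space (F t) = space M" and setsF: "sets (F t) \<subseteq> sets M" for t
    using sub by (auto simp: subalgebra_def)
  have below: "{\<omega> \<in> space M. W s \<omega> < ?c} \<in> sets (F t)" if "s \<le> t" for s t
  proof -
    have "{\<omega> \<in> space (F s). W s \<omega> < ?c} \<in> sets (F s)"
      using adapted[of s] by measurable
    with mono[OF that] show ?thesis by (auto simp: spF)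
  qed
  have G_eq: "G t = (\<Inter>s\<in>{..t}. {\<omega> \<in> space M. W s \<omega> < ?c})" for t
    by (auto simp: G_def)
  have GF: "G t \<in> sets (F t)" for t
    unfolding G_eq by (intro sets.finite_INT below) auto
  then have GM [measurable]: "G t \<in> sets M" for t
    using setsF by blast
  have WM [measurable]: "W t \<in> borel_measurable M" for t
    using measurable_from_subalg[OF sub adapted] .
  \<comment> \<open>The left-hand side is a lower bound for the expectation of \<open>W\<close> stopped on reaching \<open>?c\<close>.\<close>
  have stopped: "?c * emeasure M (space M - G t) + (\<integral>\<^sup>+\<omega>. W t \<omega> * indicator (G t) \<omega> \<partial>M) \<le> 1" for t
  proof (induction t)
    case 0
    have "?c * emeasure M (space M - G 0) + (\<integral>\<^sup>+\<omega>. W 0 \<omega> * indicator (G 0) \<omega> \<partial>M)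
        = (\<integral>\<^sup>+\<omega>. ?c * indicator (space M - G 0) \<omega> + W 0 \<omega> * indicator (G 0) \<omega> \<partial>M)"
      by (simp add: nn_integral_add nn_integral_cmult_indicator)
    also have "\<dots> \<le> (\<integral>\<^sup>+\<omega>. W 0 \<omega> \<partial>M)"
      by (intro nn_integral_mono) (auto simp: G_def indicator_def)
    finally show ?case using init by simp
  next
    case (Suc t)
    have "?c * emeasure M (space M - G (Suc t)) + (\<integral>\<^sup>+\<omega>. W (Suc t) \<omega> * indicator (G (Suc t)) \<omega> \<partial>M)
        = (\<integral>\<^sup>+\<omega>. ?c * indicator (space M - G (Suc t)) \<omega> + W (Suc t) \<omega> * indicator (G (Suc t)) \<omega> \<partial>M)"
      by (simp add: nn_integral_add nn_integral_cmult_indicator)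
    \<comment> \<open>On \<open>G t - G (Suc t)\<close> the level is first reached at time
      \<open>Suc t\<close>, so there \<open>?c\<close> is at most \<open>W (Suc t)\<close>.\<close>
    also have "\<dots> \<le> (\<integral>\<^sup>+\<omega>. ?c * indicator (space M - G t) \<omega> + W (Suc t) \<omega> * indicator (G t) \<omega> \<partial>M)"
      by (intro nn_integral_mono) (auto simp: G_def indicator_def le_Suc_eq not_less)
    also have "\<dots> = ?c * emeasure M (space M - G t) + (\<integral>\<^sup>+\<omega>. W (Suc t) \<omega> * indicator (G t) \<omega> \<partial>M)"
      by (simp add: nn_integral_add nn_integral_cmult_indicator)
    also have "\<dots> \<le> ?c * emeasure M (space M - G t) + (\<integral>\<^sup>+\<omega>. W t \<omega> * indicator (G t) \<omega> \<partial>M)"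
      by (intro add_left_mono super GF)
    finally show ?case using Suc.IH by simp
  qed
  have "1 - \<alpha> \<le> measure M (G t)" for t
  proof -
    have "?c * emeasure M (space M - G t) \<le> 1"
      using stopped[of t] by (rule order_trans[rotated]) simp
    then have "1 / \<alpha> * measure M (space M - G t) \<le> 1"
      using \<open>0 < \<alpha>\<close> by (simp add: emeasure_eq_measure ennreal_mult[symmetric])
    with \<open>0 < \<alpha>\<close> show ?thesis
      by (simp add: prob_compl field_simps)
  qed
  \<comment> \<open>Continuity from above passes from each finite horizon to all times at
    once.\<close>
  moreover have "(\<lambda>t. measure M (G t)) \<longlonglongrightarrow> measure M (\<Inter>t. G t)"
    by (intro finite_Lim_measure_decseq) (auto simp: decseq_def G_def)
  moreover have "(\<Inter>t. G t) = {\<omega> \<in> space M. \<forall>t. W t \<omega> < ?c}"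
    by (auto simp: G_def)
  ultimately show ?thesis
    by (metis (no_types, lifting) LIMSEQ_le_const)
qed

section \<open>The history filtration; trace and operator norm\<close>

lemma sets_history_mono: "s \<le> t \<Longrightarrow> sets (history M X s) \<subseteq> sets (history M X t)"
  unfolding history_def by (subst (1 2) sets_measure_of) (auto intro!: sigma_sets_mono', force)

lemma measurable_history:
  fixes X :: "nat \<Rightarrow> 'a \<Rightarrow> 'b::topological_space"
  assumes "1 \<le> i" "i \<le> t"
  shows "X i \<in> borel_measurable (history M X t)"
proof (rule measurableI)
  fix B :: "'b set" assume "B \<in> sets borel"
  then show "X i -` B \<inter> space (history M X t) \<in> sets (history M X t)"
    using assms unfolding history_def
    by (subst space_measure_of, fastforce, subst sets_measure_of) (auto intro!: sigma_sets.Basic)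
qed simp

lemma sum_Basis_quadratic_eq_trace:
  fixes S :: "real ^ 'n ^ 'n"
  shows "(\<Sum>b\<in>Basis. b \<bullet> (S *v b)) = trace S"
proof -
  have Basis_eq: "Basis = range (\<lambda>i::'n. axis i (1::real))"
    by (auto simp: Basis_vec_def)
  have inj: "inj (\<lambda>i::'n. axis i (1::real))"
    by (auto simp: inj_on_def axis_eq_axis)
  have "(\<Sum>b\<in>Basis. b \<bullet> (S *v b)) = (\<Sum>i\<in>UNIV. axis i 1 \<bullet> (S *v axis i 1))"
    unfolding Basis_eq by (subst sum.reindex[OF inj]) (simp add: o_def)
  then show ?thesis
    by (simp add: trace_def matrix_vector_mult_basis inner_axis' column_def)
qed

lemma quadratic_le_op_norm:
  fixes S :: "real ^ 'n ^ 'n"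
  shows "u \<bullet> (S *v u) \<le> op_norm S * (norm u)\<^sup>2"
proof -
  have "norm (S *v u) \<le> op_norm S * norm u"
    unfolding op_norm_def by (intro onorm matrix_vector_mul_bounded_linear)
  then have "norm u * norm (S *v u) \<le> norm u * (op_norm S * norm u)"
    by (intro mult_left_mono) auto
  with norm_cauchy_schwarz[of u "S *v u"] show ?thesis
    by (simp add: power2_eq_square mult_ac)
qed

lemma trace_nonneg: "pos_semidef S \<Longrightarrow> 0 \<le> trace S"
  unfolding pos_semidef_def sum_Basis_quadratic_eq_trace[symmetric] by (simp add: sum_nonneg)

lemma op_norm_nonneg: "0 \<le> op_norm S"
  unfolding op_norm_def by (intro onorm_pos_le matrix_vector_mul_bounded_linear)

section \<open>The sub-Gaussian supermartingale and its Gaussian mixture\<close>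

text \<open>The value at \<open>Suc t\<close> is the value at \<open>t\<close> times the exponential
  of one increment. The former, restricted to \<open>B\<close>, is measurable for the history and
  leaves the conditional expectation, while the latter has conditional expectation at most
  1.\<close>

lemma cond_sub_gaussian_supermartingale:
  fixes X :: "nat \<Rightarrow> 'a \<Rightarrow> real ^ 'n"
  assumes "prob_space M"
    and X: "\<And>t. t \<ge> 1 \<Longrightarrow> X t \<in> borel_measurable M"
    and sub_gaussian: "cond_sub_gaussian M X \<mu> S"
    and B: "B \<in> sets (history M X t)"
  shows "(\<integral>\<^sup>+\<omega>. ennreal (exp (l * (\<theta> \<bullet> (\<Sum>i=1..Suc t. X i \<omega> - \<mu>))
        - l\<^sup>2 / 2 * real (Suc t) * (\<theta> \<bullet> (S *v \<theta>)))) * indicator B \<omega> \<partial>M)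
    \<le> (\<integral>\<^sup>+\<omega>. ennreal (exp (l * (\<theta> \<bullet> (\<Sum>i=1..t. X i \<omega> - \<mu>))
        - l\<^sup>2 / 2 * real t * (\<theta> \<bullet> (S *v \<theta>)))) * indicator B \<omega> \<partial>M)"
    (is "(\<integral>\<^sup>+\<omega>. ?E (Suc t) \<omega> * _ \<partial>M) \<le> _")
proof -
  let ?H = "history M X t"
  interpret sigma_finite_subalgebra M ?H
    using assms by (intro sigma_finite_history)
  let ?g = "\<lambda>\<omega>. ennreal (exp (l * (\<theta> \<bullet> (X (Suc t) \<omega> - \<mu>)) - l\<^sup>2 / 2 * (\<theta> \<bullet> (S *v \<theta>))))"
  have [measurable]: "X i \<in> borel_measurable ?H" if "i \<in> {1..t}" for i
    using that by (intro measurable_history) auto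
  have [measurable]: "X (Suc t) \<in> borel_measurable M" and [measurable]: "B \<in> sets ?H"
    using X B by auto
  have "(\<integral>\<^sup>+\<omega>. ?E (Suc t) \<omega> * indicator B \<omega> \<partial>M) = (\<integral>\<^sup>+\<omega>. (?E t \<omega> * indicator B \<omega>) * ?g \<omega> \<partial>M)"
    by (intro nn_integral_cong)
      (simp add: ennreal_mult[symmetric] exp_add[symmetric] algebra_simps inner_add_right indicator_def)
  also have "\<dots> = (\<integral>\<^sup>+\<omega>. (?E t \<omega> * indicator B \<omega>) * nn_cond_exp M ?H ?g \<omega> \<partial>M)"
    by (intro nn_cond_exp_intg[symmetric]) measurable
  also have "\<dots> \<le> (\<integral>\<^sup>+\<omega>. (?E t \<omega> * indicator B \<omega>) * 1 \<partial>M)"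
  proof (rule nn_integral_mono_AE)
    \<comment> \<open>The definition conditions \<open>X t\<close> on
      \<open>history M X (t - 1)\<close>, so it is used at time \<open>Suc t\<close>.\<close>
    have "AE \<omega> in M. nn_cond_exp M ?H ?g \<omega> \<le> 1"
      using sub_gaussian unfolding cond_sub_gaussian_def by (metis diff_Suc_1 le_add1 plus_1_eq_Suc)
    then show "AE \<omega> in M. (?E t \<omega> * indicator B \<omega>) * nn_cond_exp M ?H ?g \<omega> \<le> (?E t \<omega> * indicator B \<omega>) * 1"
      by eventually_elim (intro mult_left_mono, auto)
  qed
  finally show ?thesis by simp
qed

text \<open>Ville's inequality bounds the mixture from above and recentring bounds it from below.
  For fixed \<open>l\<close> and \<open>\<sigma>\<close> this gives a boundary that is affine in
  \<open>t\<close>; the parameters are chosen later.\<close>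

lemma sub_gaussian_norm_bound_line:
  fixes X :: "nat \<Rightarrow> 'a \<Rightarrow> real ^ 'n"
  assumes "prob_space M"
    and X: "\<And>t. t \<ge> 1 \<Longrightarrow> X t \<in> borel_measurable M"
    and sub_gaussian: "cond_sub_gaussian M X \<mu> S"
    and "0 < l" "0 < \<sigma>" "0 < \<alpha>"
  shows "measure M {\<omega> \<in> space M. \<forall>t\<ge>1. l * norm (\<Sum>i=1..t. X i \<omega> - \<mu>)
      \<le> l\<^sup>2 / 2 * real t * (op_norm S + \<sigma>\<^sup>2 * trace S) + 1 / (2 * \<sigma>\<^sup>2) + ln (1 / \<alpha>)} \<ge> 1 - \<alpha>"
    (is "measure M ?G \<ge> _")
proof -
  interpret prob_space M by fact
  define Z where "Z t \<omega> = (\<Sum>i=1..t. X i \<omega> - \<mu>)" for t \<omega>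
  define E where "E t \<omega> \<theta> = ennreal (exp (\<theta> \<bullet> (l *\<^sub>R Z t \<omega>) - (l\<^sup>2 / 2 * real t) * (\<theta> \<bullet> (S *v \<theta>)))
      * iso_normal_density \<sigma> \<theta>)" for t \<omega> \<theta>
  define W where "W t \<omega> = (\<integral>\<^sup>+\<theta>. E t \<omega> \<theta> \<partial>lborel)" for t \<omega>
  have sub: "subalgebra M (history M X t)" for t
    using X by (rule subalgebra_history)
  have Z_history [measurable]: "Z t \<in> borel_measurable (history M X t)" for t
    unfolding Z_def[abs_def]
    by (intro borel_measurable_sum borel_measurable_diff measurable_history) auto
  have Z_M [measurable]: "Z t \<in> borel_measurable M" for t
    using measurable_from_subalg[OF sub Z_history] .
  have [measurable]: "(*v) S \<in> borel_measurable borel"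
    by (rule borel_measurable_linear) (rule matrix_vector_mul_linear)
  have E_history [measurable]: "(\<lambda>(\<omega>, \<theta>). E t \<omega> \<theta>) \<in> borel_measurable (history M X t \<Otimes>\<^sub>M lborel)" for t
    unfolding E_def by measurable
  have E_M [measurable]: "(\<lambda>(\<omega>, \<theta>). E t \<omega> \<theta>) \<in> borel_measurable (M \<Otimes>\<^sub>M lborel)" for t
    unfolding E_def by measurable
  have E_super: "(\<integral>\<^sup>+\<omega>. E (Suc t) \<omega> \<theta> * indicator B \<omega> \<partial>M) \<le> (\<integral>\<^sup>+\<omega>. E t \<omega> \<theta> * indicator B \<omega> \<partial>M)"
    if B: "B \<in> sets (history M X t)" for B t \<theta>
  proof -
    let ?e = "\<lambda>t \<omega>. ennreal (exp (l * (\<theta> \<bullet> Z t \<omega>) - l\<^sup>2 / 2 * real t * (\<theta> \<bullet> (S *v \<theta>)))) * indicator B \<omega>"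
    have [measurable]: "B \<in> sets M"
      using B sub[of t] by (auto simp: subalgebra_def)
    have "E t \<omega> \<theta> * indicator B \<omega> = ennreal (iso_normal_density \<sigma> \<theta>) * ?e t \<omega>" for t \<omega>
      by (simp add: E_def ennreal_mult mult_ac)
    then have "(\<integral>\<^sup>+\<omega>. E t \<omega> \<theta> * indicator B \<omega> \<partial>M)
        = ennreal (iso_normal_density \<sigma> \<theta>) * (\<integral>\<^sup>+\<omega>. ?e t \<omega> \<partial>M)" for t
      by (simp add: nn_integral_cmult)
    then show ?thesis
      using cond_sub_gaussian_supermartingale[OF assms(1) X sub_gaussian B]
      by (simp only: Z_def mult_left_mono zero_le)
  qed
  \<comment> \<open>Tonelli: the supermartingale inequality for each \<open>\<theta>\<close> can
    then be integrated over \<open>\<theta>\<close>.\<close>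
  have W_eq: "(\<integral>\<^sup>+\<omega>. W t \<omega> * indicator B \<omega> \<partial>M) = (\<integral>\<^sup>+\<theta>. \<integral>\<^sup>+\<omega>. E t \<omega> \<theta> * indicator B \<omega> \<partial>M \<partial>lborel)"
    if [measurable]: "B \<in> sets M" for B t
  proof -
    interpret pair_sigma_finite M "lborel :: (real ^ 'n) measure" ..
    have "(\<integral>\<^sup>+\<omega>. W t \<omega> * indicator B \<omega> \<partial>M) = (\<integral>\<^sup>+\<omega>. \<integral>\<^sup>+\<theta>. E t \<omega> \<theta> * indicator B \<omega> \<partial>lborel \<partial>M)"
      unfolding W_def by (intro nn_integral_cong nn_integral_multc[symmetric]) measurable
    also have "\<dots> = (\<integral>\<^sup>+\<theta>. \<integral>\<^sup>+\<omega>. E t \<omega> \<theta> * indicator B \<omega> \<partial>M \<partial>lborel)"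
      by (intro Fubini'[symmetric]) measurable
    finally show ?thesis .
  qed
  have "1 - \<alpha> \<le> measure M {\<omega> \<in> space M. \<forall>t. W t \<omega> < ennreal (1 / \<alpha>)}"
  proof (rule ville_inequality[where F = "history M X"])
    show "W t \<in> borel_measurable (history M X t)" for t
      unfolding W_def[abs_def] by measurable
    show "(\<integral>\<^sup>+\<omega>. W (Suc t) \<omega> * indicator B \<omega> \<partial>M) \<le> (\<integral>\<^sup>+\<omega>. W t \<omega> * indicator B \<omega> \<partial>M)"
      if B: "B \<in> sets (history M X t)" for t B
    proof -
      have "B \<in> sets M"
        using B sub[of t] by (auto simp: subalgebra_def)
      then show ?thesis
        using E_super[OF B] by (simp add: W_eq nn_integral_mono)
    qed
    \<comment> \<open>At time 0 the sum is empty, so only the total mass of the Gaussian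
      remains.\<close>
    have "W 0 \<omega> = 1" for \<omega>
    proof -
      have "W 0 \<omega> = (\<integral>\<^sup>+\<theta>. ennreal (iso_normal_density \<sigma> (\<theta> :: real ^ 'n)) \<partial>lborel)"
        by (simp add: W_def E_def Z_def)
      also have "\<dots> = 1"
        using has_bochner_integral_iso_normal_density[OF \<open>0 < \<sigma>\<close>, where 'a = "real ^ 'n"]
        by (subst nn_integral_eq_integral) (auto simp: has_bochner_integral_iff)
      finally show ?thesis .
    qed
    then show "(\<integral>\<^sup>+\<omega>. W 0 \<omega> \<partial>M) \<le> 1"
      by (simp add: emeasure_space_1)
    show "sets (history M X s) \<subseteq> sets (history M X t)" if "s \<le> t" for s t
      using that by (rule sets_history_mono)
  qed (use assms sub in auto)
  also have "\<dots> \<le> measure M ?G"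
  proof (rule finite_measure_mono)
    show "?G \<in> sets M"
      unfolding Z_def[symmetric] by measurable
    show "{\<omega> \<in> space M. \<forall>t. W t \<omega> < ennreal (1 / \<alpha>)} \<subseteq> ?G"
    proof safe
      fix \<omega> and t :: nat
      assume W: "\<forall>t. W t \<omega> < ennreal (1 / \<alpha>)" and "1 \<le> t"
      \<comment> \<open>If \<open>Z t \<omega> = 0\<close> then \<open>u = 0\<close> because
        \<open>1 / 0 = 0\<close>; hence the bound \<open>norm u \<le> 1\<close> rather than an
        equality.\<close>
      define u where "u = (1 / norm (Z t \<omega>)) *\<^sub>R Z t \<omega>"
      have u: "u \<bullet> Z t \<omega> = norm (Z t \<omega>)" "norm u \<le> 1"
        by (auto simp: u_def power2_norm_eq_inner[symmetric] power2_eq_square)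
      define y where "y = u \<bullet> (l *\<^sub>R Z t \<omega>)
        - (l\<^sup>2 / 2 * real t) * (u \<bullet> (S *v u) + \<sigma>\<^sup>2 * trace S) - (norm u)\<^sup>2 / (2 * \<sigma>\<^sup>2)"
      \<comment> \<open>The recentred bound with \<open>s = l *\<^sub>R Z t \<omega>\<close> and
        \<open>k = l\<^sup>2 / 2 * real t\<close>.\<close>
      have "ennreal (exp y) \<le> W t \<omega>"
        unfolding y_def W_def E_def sum_Basis_quadratic_eq_trace[symmetric]
        by (intro exp_quadratic_iso_normal_ge_shift \<open>0 < \<sigma>\<close> matrix_vector_mul_linear)
      also have "\<dots> < ennreal (1 / \<alpha>)"
        using W by blast
      finally have "exp y < 1 / \<alpha>"
        using \<open>0 < \<alpha>\<close> by (simp add: ennreal_less_iff)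
      then have "y < ln (1 / \<alpha>)"
        using \<open>0 < \<alpha>\<close> by (metis exp_gt_zero ln_exp ln_less_cancel_iff less_trans)
      moreover have "(norm u)\<^sup>2 \<le> 1"
        using u(2) by (simp add: power_le_one)
      then have "(norm u)\<^sup>2 / (2 * \<sigma>\<^sup>2) \<le> 1 / (2 * \<sigma>\<^sup>2)"
        by (intro divide_right_mono) auto
      moreover have "op_norm S * (norm u)\<^sup>2 \<le> op_norm S * 1"
        using \<open>(norm u)\<^sup>2 \<le> 1\<close> op_norm_nonneg by (intro mult_left_mono)
      then have "u \<bullet> (S *v u) \<le> op_norm S"
        using quadratic_le_op_norm[of u S] by simp
      then have "(l\<^sup>2 / 2 * real t) * (u \<bullet> (S *v u) + \<sigma>\<^sup>2 * trace S)
          \<le> (l\<^sup>2 / 2 * real t) * (op_norm S + \<sigma>\<^sup>2 * trace S)"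
        by (intro mult_left_mono) auto
      ultimately show "l * norm (\<Sum>i=1..t. X i \<omega> - \<mu>)
          \<le> l\<^sup>2 / 2 * real t * (op_norm S + \<sigma>\<^sup>2 * trace S) + 1 / (2 * \<sigma>\<^sup>2) + ln (1 / \<alpha>)"
        unfolding Z_def[symmetric] y_def by (simp add: u)
    qed
  qed
  finally show ?thesis .
qed

section \<open>Choice of the parameters\<close>

text \<open>Dividing the affine boundary by \<open>l * real t\<close> gives the stated shape. The
  positive majorants \<open>a\<close> and \<open>v\<close> keep the optimal parameters well defined
  when the operator norm or the trace of \<open>S\<close> vanishes.\<close>

lemma sub_gaussian_mean_bound:
  fixes X :: "nat \<Rightarrow> 'a \<Rightarrow> real ^ 'n"
  assumes "prob_space M"
    and X: "\<And>t. t \<ge> 1 \<Longrightarrow> X t \<in> borel_measurable M"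
    and sub_gaussian: "cond_sub_gaussian M X \<mu> S"
    and a: "op_norm S \<le> a" "0 < a" and v: "trace S \<le> v" "0 < v"
    and n: "1 \<le> n" and \<alpha>: "0 < \<alpha>" "\<alpha> < 1"
  shows "measure M {\<omega> \<in> space M. \<forall>t\<ge>1.
      norm ((1 / real t) *\<^sub>R (\<Sum>i=1..t. X i \<omega>) - \<mu>)
        \<le> (1 / (2 * sqrt (real n)) + sqrt (real n) / (2 * real t))
          * (sqrt v + sqrt (2 * a * ln (1 / \<alpha>)))} \<ge> 1 - \<alpha>"
    (is "measure M ?G \<ge> _")
proof -
  interpret prob_space M by fact
  \<comment> \<open>With the square roots as atoms, the comparison of the two boundaries becomes a
    rational identity.\<close>
  define p where "p = sqrt a"
  define q where "q = sqrt v"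
  define r where "r = sqrt (2 * ln (1 / \<alpha>))"
  define m where "m = sqrt (real n)"
  have "0 < ln (1 / \<alpha>)"
    using \<alpha> by simp
  then have pos: "0 < p" "0 < q" "0 < r" "0 < m"
    using a v n by (auto simp: p_def q_def r_def m_def)
  have sq: "p\<^sup>2 = a" "q\<^sup>2 = v" "r\<^sup>2 = 2 * ln (1 / \<alpha>)"
    using a v \<open>0 < ln (1 / \<alpha>)\<close> by (auto simp: p_def q_def r_def)
  \<comment> \<open>These values minimise the bound of the previous lemma at \<open>t = n\<close>.\<close>
  define l where "l = r / (p * m)"
  define \<sigma> where "\<sigma> = sqrt (p / (q * r))"
  have "0 < l" "0 < \<sigma>" and \<sigma>2: "\<sigma>\<^sup>2 = p / (q * r)"
    using pos by (auto simp: l_def \<sigma>_def)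
  let ?L = "{\<omega> \<in> space M. \<forall>t\<ge>1. l * norm (\<Sum>i=1..t. X i \<omega> - \<mu>)
      \<le> l\<^sup>2 / 2 * real t * (op_norm S + \<sigma>\<^sup>2 * trace S) + 1 / (2 * \<sigma>\<^sup>2) + ln (1 / \<alpha>)}"
  have "1 - \<alpha> \<le> measure M ?L"
    by (rule sub_gaussian_norm_bound_line) fact+
  also have "\<dots> \<le> measure M ?G"
  proof (rule finite_measure_mono)
    have [measurable]: "(\<lambda>\<omega>. \<Sum>i=1..t. X i \<omega>) \<in> borel_measurable M" for t
      using X by (intro borel_measurable_sum) auto
    show "?G \<in> sets M"
      by measurable
    show "?L \<subseteq> ?G"
    proof safe
      fix \<omega> and t :: nat
      assume L: "\<forall>t\<ge>1. l * norm (\<Sum>i=1..t. X i \<omega> - \<mu>)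
          \<le> l\<^sup>2 / 2 * real t * (op_norm S + \<sigma>\<^sup>2 * trace S) + 1 / (2 * \<sigma>\<^sup>2) + ln (1 / \<alpha>)"
        and t: "1 \<le> t"
      define z where "z = norm (\<Sum>i=1..t. X i \<omega> - \<mu>)"
      have "l * z \<le> l\<^sup>2 / 2 * real t * (op_norm S + \<sigma>\<^sup>2 * trace S) + 1 / (2 * \<sigma>\<^sup>2) + ln (1 / \<alpha>)"
        using L t by (simp add: z_def)
      also have "\<dots> \<le> l\<^sup>2 / 2 * real t * (p\<^sup>2 + \<sigma>\<^sup>2 * q\<^sup>2) + 1 / (2 * \<sigma>\<^sup>2) + r\<^sup>2 / 2"
        using a v by (intro add_mono mult_left_mono) (auto simp: sq)
      \<comment> \<open>The slope is \<open>l * (q + p * r) / (2 * m)\<close> and the constant term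
        is \<open>l * m * (q + p * r) / 2\<close>; the common factor \<open>q + p * r\<close> makes
        this exact for every \<open>t\<close>.\<close>
      also have "\<dots> = l * (real t * (1 / (2 * m) + m / (2 * real t)) * (q + p * r))"
        unfolding \<sigma>2 l_def using pos t by (simp add: field_simps power2_eq_square)
      finally have "z \<le> real t * (1 / (2 * m) + m / (2 * real t)) * (q + p * r)"
        using \<open>0 < l\<close> by simp
      moreover have "norm ((1 / real t) *\<^sub>R (\<Sum>i=1..t. X i \<omega>) - \<mu>) = z / real t"
      proof -
        have "(1 / real t) *\<^sub>R (\<Sum>i=1..t. X i \<omega>) - \<mu> = (1 / real t) *\<^sub>R (\<Sum>i=1..t. X i \<omega> - \<mu>)"
          using t by (simp add: sum_subtractf scaleR_diff_right sum_constant_scaleR del: sum_constant)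
        then show ?thesis by (simp add: z_def)
      qed
      moreover have "sqrt (2 * a * ln (1 / \<alpha>)) = p * r"
        by (simp add: p_def r_def real_sqrt_mult)
      ultimately show "norm ((1 / real t) *\<^sub>R (\<Sum>i=1..t. X i \<omega>) - \<mu>)
          \<le> (1 / (2 * sqrt (real n)) + sqrt (real n) / (2 * real t))
            * (sqrt v + sqrt (2 * a * ln (1 / \<alpha>)))"
        using t by (simp add: m_def[symmetric] q_def[symmetric] divide_le_eq mult_ac)
    qed
  qed
  finally show ?thesis .
qed

section \<open>Passage to the limit in the majorants\<close>

theorem corollary2p5:
  fixes M :: "'a measure"
    and X :: "nat \<Rightarrow> 'a \<Rightarrow> real ^ 'd"
    and \<mu> :: "real ^ 'd"
    and \<Sigma> :: "real ^ 'd ^ 'd"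
    and n :: nat
    and \<alpha> :: real
  assumes "prob_space M"
    and "pos_semidef \<Sigma>"
    and "\<And>t. t \<ge> 1 \<Longrightarrow> X t \<in> borel_measurable M"
    and "\<And>t. t \<ge> 1 \<Longrightarrow> has_cond_mean M (history M X (t - 1)) (X t) \<mu>"
    and "cond_sub_gaussian M X \<mu> \<Sigma>"
    and "n \<ge> 1"
    and "0 < \<alpha>" and "\<alpha> < 1"
  shows "measure M {\<omega> \<in> space M. \<forall>t\<ge>1.
           norm ((1 / real t) *\<^sub>R (\<Sum>i=1..t. X i \<omega>) - \<mu>)
             \<le> (1 / (2 * sqrt (real n)) + sqrt (real n) / (2 * real t))
                * (sqrt (trace \<Sigma>) + sqrt (2 * op_norm \<Sigma> * ln (1 / \<alpha>)))} \<ge> 1 - \<alpha>"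
proof -
  interpret prob_space M by fact
  \<comment> \<open>The optimal parameters degenerate when \<open>\<Sigma> = 0\<close>; enlarging \<open>trace \<Sigma>\<close> and \<open>op_norm \<Sigma>\<close> by
    \<open>\<epsilon> k\<close> and letting \<open>k\<close> tend to infinity covers this case too.\<close>
  define \<epsilon> where "\<epsilon> k = 1 / real (Suc k)" for k
  have \<epsilon>_pos: "0 < \<epsilon> k" for k
    by (simp add: \<epsilon>_def)
  have \<epsilon>_decseq: "\<epsilon> k' \<le> \<epsilon> k" if "k \<le> k'" for k k'
    using that by (simp add: \<epsilon>_def frac_le)
  have \<epsilon>_lim: "\<epsilon> \<longlonglongrightarrow> 0"
    unfolding \<epsilon>_def[abs_def] using LIMSEQ_Suc[OF lim_1_over_n] by simp
  define N where "N t \<omega> = norm ((1 / real t) *\<^sub>R (\<Sum>i=1..t. X i \<omega>) - \<mu>)" for t \<omega>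
  define C where "C t = 1 / (2 * sqrt (real n)) + sqrt (real n) / (2 * real t)" for t
  define R where "R e = sqrt (trace \<Sigma> + e) + sqrt (2 * (op_norm \<Sigma> + e) * ln (1 / \<alpha>))" for e
  define G where "G k = {\<omega> \<in> space M. \<forall>t\<ge>1. N t \<omega> \<le> C t * R (\<epsilon> k)}" for k
  have C_nonneg: "0 \<le> C t" for t
    by (simp add: C_def)
  have [measurable]: "N t \<in> borel_measurable M" for t
  proof -
    have [measurable]: "(\<lambda>\<omega>. \<Sum>i=1..t. X i \<omega>) \<in> borel_measurable M"
      using assms(3) by (intro borel_measurable_sum) auto
    show ?thesis unfolding N_def[abs_def] by measurable
  qed
  have "range G \<subseteq> sets M"
    unfolding G_def by (intro image_subsetI) measurable
  \<comment> \<open>\<open>R\<close> is increasing and \<open>C t\<close> nonnegative, so the events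
    shrink as \<open>\<epsilon> k\<close> decreases.\<close>
  moreover have "decseq G"
  proof (unfold decseq_def G_def, safe)
    fix k k' \<omega> and t :: nat
    assume "k \<le> k'" and *: "\<forall>t\<ge>1. N t \<omega> \<le> C t * R (\<epsilon> k')" and "1 \<le> t"
    have "R (\<epsilon> k') \<le> R (\<epsilon> k)"
      unfolding R_def using \<epsilon>_decseq[OF \<open>k \<le> k'\<close>] assms(7,8)
      by (intro add_mono real_sqrt_le_mono mult_right_mono mult_left_mono) auto
    then show "N t \<omega> \<le> C t * R (\<epsilon> k)"
      using * \<open>1 \<le> t\<close> mult_left_mono[OF _ C_nonneg] order_trans by meson
  qed
  ultimately have "(\<lambda>k. measure M (G k)) \<longlonglongrightarrow> measure M (\<Inter>k. G k)"
    by (rule finite_Lim_measure_decseq)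
  moreover have "1 - \<alpha> \<le> measure M (G k)" for k
  proof -
    \<comment> \<open>Positive semidefiniteness makes the trace nonnegative, so adding
      \<open>\<epsilon> k\<close> makes it positive.\<close>
    have "op_norm \<Sigma> \<le> op_norm \<Sigma> + \<epsilon> k" "0 < op_norm \<Sigma> + \<epsilon> k"
      "trace \<Sigma> \<le> trace \<Sigma> + \<epsilon> k" "0 < trace \<Sigma> + \<epsilon> k"
      using \<epsilon>_pos[of k] op_norm_nonneg[of \<Sigma>] trace_nonneg[OF assms(2)] by linarith+
    from sub_gaussian_mean_bound[OF assms(1,3,5) this assms(6-8)] show ?thesis
      by (simp only: G_def N_def C_def R_def)
  qed
  ultimately have "1 - \<alpha> \<le> measure M (\<Inter>k. G k)"
    by (metis (no_types, lifting) LIMSEQ_le_const)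
  \<comment> \<open>Continuity of \<open>R\<close> at 0 gives one inclusion, monotonicity of
    \<open>R\<close> the other.\<close>
  moreover have "(\<Inter>k. G k) = {\<omega> \<in> space M. \<forall>t\<ge>1. N t \<omega> \<le> C t * R 0}"
  proof (intro set_eqI iffI)
    fix \<omega> assume \<omega>: "\<omega> \<in> (\<Inter>k. G k)"
    have lim: "(\<lambda>k. C t * R (\<epsilon> k)) \<longlonglongrightarrow> C t * R 0" for t
      unfolding R_def by (intro tendsto_intros \<epsilon>_lim)
    have "N t \<omega> \<le> C t * R 0" if "1 \<le> t" for t
    proof (rule LIMSEQ_le_const[OF lim])
      show "\<exists>k0. \<forall>k\<ge>k0. N t \<omega> \<le> C t * R (\<epsilon> k)"
        using that \<omega> by (auto simp: G_def)
    qed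
    with \<omega> show "\<omega> \<in> {\<omega> \<in> space M. \<forall>t\<ge>1. N t \<omega> \<le> C t * R 0}"
      by (auto simp: G_def)
  next
    fix \<omega> assume \<omega>: "\<omega> \<in> {\<omega> \<in> space M. \<forall>t\<ge>1. N t \<omega> \<le> C t * R 0}"
    have "R 0 \<le> R (\<epsilon> k)" for k
      unfolding R_def using \<epsilon>_pos[of k] assms(7,8)
      by (intro add_mono real_sqrt_le_mono mult_right_mono mult_left_mono) auto
    then have "C t * R 0 \<le> C t * R (\<epsilon> k)" for t k
      by (intro mult_left_mono C_nonneg)
    with \<omega> show "\<omega> \<in> (\<Inter>k. G k)"
      by (auto simp: G_def intro: order_trans)
  qed
  ultimately show ?thesis
    by (simp add: N_def C_def R_def)
qed

end
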